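(* Let $n\ge 1$ be an integer. When restricted to the matchings of $[2n]$ with no neighbor nestings, the map $\psi$ (defined in the context) is a bijection onto $\mathcal{T}_n$.
   Context: $[m]=\{1,\dots,m\}$. A matching of $[2n]$ is a partition of $[2n]$ into blocks of size $2$; the blocks are called arcs and written $(i,j)$ with $i<j$; $i$ is the opener and $j$ the closer of the arc. A nesting is a pair of arcs $(i,\ell)$, $(j,k)$ with $i<j<k<\ell$; it is a left-nesting if $j=i+1$ and a right-nesting if $\ell=k+1$. A matching has no neighbor nestings if it has neither left-nestings nor right-nestings. $\mathcal{T}_n$ is the set of upper triangular (square) matrices, of any size, with non-negative integer entries, such that no row or column has only zeros and the total sum of the entries is $n$. Map $\psi$: for a matching $M$ of $[2n]$ let $O(M)$ and $C(M)$ be its sets of openers and closers. Write $O(M)=O_1\cup\dots\cup O_k$ and $C(M)=C_1\cup\dots\cup C_k$ as disjoint unions of maximal intervals of consecutive integers, each list ordered in the natural order (the number $k$ of intervals is the same for openers and closers). Then $\psi(M)=(t_{ij})$ is the $k\times k$ matrix with $t_{ij}=|M\cap (O_i\times C_j)|$, the number of arcs whose opener is in $O_i$ and whose closer is in $C_j$. *)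

theory Defs
  imports "Jordan_Normal_Form.Matrix" "HOL-Library.Disjoint_Sets"
begin

type_synonym matching = "nat set set"

definition is_matching :: "nat \<Rightarrow> matching \<Rightarrow> bool" where
  "is_matching m M \<longleftrightarrow> partition_on {1..m} M \<and> (\<forall>B\<in>M. card B = 2)"

definition arcs :: "matching \<Rightarrow> (nat \<times> nat) set" where
  "arcs M = {(i, j). i < j \<and> {i, j} \<in> M}"

definition openers :: "matching \<Rightarrow> nat set" where
  "openers M = fst ` arcs M"

definition closers :: "matching \<Rightarrow> nat set" where
  "closers M = snd ` arcs M"

definition is_nesting :: "matching \<Rightarrow> nat \<times> nat \<Rightarrow> nat \<times> nat \<Rightarrow> bool" where
  "is_nesting M = (\<lambda>(i, l) (j, k).
     (i, l) \<in> arcs M \<and> (j, k) \<in> arcs M \<and> i < j \<and> j < k \<and> k < l)"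

definition is_left_nesting :: "matching \<Rightarrow> nat \<times> nat \<Rightarrow> nat \<times> nat \<Rightarrow> bool" where
  "is_left_nesting M a b \<longleftrightarrow> is_nesting M a b \<and> fst b = fst a + 1"

definition is_right_nesting :: "matching \<Rightarrow> nat \<times> nat \<Rightarrow> nat \<times> nat \<Rightarrow> bool" where
  "is_right_nesting M a b \<longleftrightarrow> is_nesting M a b \<and> snd a = snd b + 1"

definition no_neighbor_nestings :: "matching \<Rightarrow> bool" where
  "no_neighbor_nestings M \<longleftrightarrow>
     \<not> (\<exists>a b. is_left_nesting M a b) \<and> \<not> (\<exists>a b. is_right_nesting M a b)"

definition maximal_intervals :: "nat set \<Rightarrow> nat set set" where
  "maximal_intervals S =
     {I. I \<noteq> {} \<and> (\<exists>a b. I = {a..b}) \<and> I \<subseteq> S \<and>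
         (\<forall>a b. I \<subseteq> {a..b} \<longrightarrow> {a..b} \<subseteq> S \<longrightarrow> {a..b} = I)}"

(* Maximal intervals of the same set are pairwise disjoint, so their natural order
   is the order of their minima. *)
definition interval_list :: "nat set \<Rightarrow> nat set list" where
  "interval_list S = sorted_key_list_of_set Min (maximal_intervals S)"

(* Row and column indices start at 0. For a matching of {1..2n} the number of maximal
   intervals is the same for openers and closers, because 1 is an opener and 2n is a
   closer, so psi M is a square matrix. *)
definition psi :: "matching \<Rightarrow> nat mat" where
  "psi M = (let Os = interval_list (openers M); Cs = interval_list (closers M) in
     mat (length Os) (length Cs) (\<lambda>(i, j). card (arcs M \<inter> (Os ! i \<times> Cs ! j))))"

definition T :: "nat \<Rightarrow> nat mat set" where
  "T n = {A. square_mat A \<and> upper_triangular A \<and>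
             (\<forall>i < dim_row A. row A i \<noteq> 0\<^sub>v (dim_col A)) \<and>
             (\<forall>j < dim_col A. col A j \<noteq> 0\<^sub>v (dim_row A)) \<and>
             sum_mat A = n}"

end

theory Submission
  imports Defs "HOL-Library.Product_Lexorder"
begin

text \<open>
  Read a matching of \<open>{1..2n}\<close> from left to right and cut it after every closer that is followed by
  an opener. Each of the resulting blocks is a run of openers followed by a run of closers, and
  the run of openers in block i is the i-th maximal interval of openers, likewise for closers.
  Writing \<open>\<beta>\<close> for the block number, the entry \<open>(i, j)\<close> of \<open>psi M\<close> therefore counts the arcs
  \<open>(a, b)\<close> with \<open>\<beta> a = i\<close> and \<open>\<beta> b = j\<close> (lemma \<open>psi_block_numbering\<close>). Every block has
  an opener and a closer, so no row or column vanishes, and \<open>a < b\<close> makes the matrix upper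
  triangular.

  Absence of neighbor nestings means that the partner map is increasing on every run of openers and
  on every run of closers. This forces the matching: within a run of openers, the partners
  go to the closer runs in increasing order, and symmetrically. To make this precise, an entry
  \<open>t\<close> at \<open>(i, j)\<close> is regarded as \<open>t\<close> arcs, numbered by \<open>m < t\<close>, and each of these is split
  into an opener half \<open>(i, False, j, m)\<close> and a closer half \<open>(j, True, i, m)\<close>. Ordered
  lexicographically, the first component says in which block the half-arc lies, the flag puts
  openers before closers within the block, and the last two components order each run by the
  block of the partner and then by the number of the arc. A matching belonging to a matrix is
  thus given by listing the \<open>2n\<close> half-arcs of the matrix in lexicographic order and joining the
  positions of the two halves of each arc.

  Listing the half-arcs of any matrix in \<open>T n\<close> yields a matching without neighbor nestings that
  is mapped back to this matrix (\<open>ex_labels\<close>, \<open>labels_psi\<close>, \<open>labels_no_neighbor_nestings\<close>):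
  this is surjectivity. Conversely, every matching without neighbor nestings arises in this
  way from its own matrix (\<open>no_neighbor_nestings_imp_labels\<close>). Since a finite set has only one
  increasing enumeration (\<open>labels_unique\<close>), two such matchings with the same matrix are equal:
  this is injectivity.
\<close>

section \<open>Matchings as fixed-point-free involutions\<close>

text \<open>
  With the partner map \<open>p\<close>, openers and closers are told apart by comparing \<open>x\<close> with \<open>p x\<close>, and
  arguments about openers and closers can be treated together.
\<close>

definition pairs_up :: "nat \<Rightarrow> (nat \<Rightarrow> nat) \<Rightarrow> matching \<Rightarrow> bool" where
  "pairs_up N p M \<longleftrightarrow>
     (\<forall>x\<in>{1..N}. p x \<in> {1..N} \<and> p x \<noteq> x \<and> p (p x) = x) \<and> M = (\<lambda>x. {x, p x}) ` {1..N}"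

lemma pairs_upD:
  assumes "pairs_up N p M" "x \<in> {1..N}"
  shows "p x \<in> {1..N}" "p x \<noteq> x" "p (p x) = x"
  using assms by (auto simp: pairs_up_def)

lemma is_matching_imp_pairs_up:
  assumes "is_matching N M"
  obtains p where "pairs_up N p M"
proof -
  have part: "partition_on {1..N} M" and two: "\<And>B. B \<in> M \<Longrightarrow> card B = 2"
    using assms by (auto simp: is_matching_def)
  have U: "\<Union>M = {1..N}" and dis: "\<And>B C x. B \<in> M \<Longrightarrow> C \<in> M \<Longrightarrow> x \<in> B \<Longrightarrow> x \<in> C \<Longrightarrow> B = C"
    using part by (auto simp: partition_on_def disjoint_def)
  have "\<exists>y. y \<noteq> x \<and> {x, y} \<in> M" if "x \<in> {1..N}" for x
  proof -
    have "x \<in> \<Union>M" using U that by simp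
    then obtain B where B: "B \<in> M" "x \<in> B" by blast
    then obtain u v where uv: "B = {u, v}" "u \<noteq> v" using two card_2_iff by metis
    show ?thesis
    proof (cases "x = u")
      case True
      then show ?thesis using B uv by auto
    next
      case False
      then have "B = {x, u}" using B uv by auto
      then show ?thesis using B False by auto
    qed
  qed
  then obtain p where p: "\<And>x. x \<in> {1..N} \<Longrightarrow> p x \<noteq> x \<and> {x, p x} \<in> M" by metis
  have rng: "p x \<in> {1..N}" if "x \<in> {1..N}" for x using p[OF that] U by blast
  have inv: "p (p x) = x" if "x \<in> {1..N}" for x
  proof -
    have "{p x, p (p x)} = {x, p x}"
      using dis[of "{p x, p (p x)}" "{x, p x}" "p x"] p[OF that] p[OF rng[OF that]] by simp
    then show ?thesis using p[OF that] by (auto simp: doubleton_eq_iff)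
  qed
  have "B \<in> (\<lambda>x. {x, p x}) ` {1..N}" if B: "B \<in> M" for B
  proof -
    obtain u v where uv: "B = {u, v}" using two[OF B] by (auto simp: card_2_iff)
    have u: "u \<in> {1..N}" using U that uv by blast
    then have "B = {u, p u}" using dis[of B "{u, p u}" u] that p[OF u] uv by blast
    then show ?thesis using u by blast
  qed
  then have "M = (\<lambda>x. {x, p x}) ` {1..N}" using p by blast
  then have "pairs_up N p M" unfolding pairs_up_def using p rng inv by (intro conjI ballI) simp_all
  then show thesis by (rule that)
qed

lemma pairs_up_imp_is_matching:
  assumes "pairs_up N p M"
  shows "is_matching N M"
proof -
  note p = pairs_upD[OF assms]
  have M: "M = (\<lambda>x. {x, p x}) ` {1..N}" using assms by (simp add: pairs_up_def)
  have "disjoint M"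
    unfolding disjoint_def M
  proof (intro ballI impI)
    fix a b assume "a \<in> (\<lambda>x. {x, p x}) ` {1..N}" "b \<in> (\<lambda>x. {x, p x}) ` {1..N}" "a \<noteq> b"
    then obtain x y where xy: "x \<in> {1..N}" "y \<in> {1..N}" "a = {x, p x}" "b = {y, p y}" by blast
    then show "a \<inter> b = {}" using p(3)[OF xy(1)] p(3)[OF xy(2)] \<open>a \<noteq> b\<close> by auto
  qed
  moreover have "\<Union>M = {1..N}" using p(1) unfolding M by blast
  moreover have "{} \<notin> M" unfolding M by blast
  moreover have "\<forall>B\<in>M. card B = 2"
  proof
    fix B assume "B \<in> M"
    then obtain x where "x \<in> {1..N}" "B = {x, p x}" unfolding M by blast
    then show "card B = 2" using p(2)[of x] by simp
  qed
  ultimately show ?thesis by (simp add: is_matching_def partition_on_def)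
qed

lemma arcs_pairs_up:
  assumes "pairs_up N p M"
  shows "arcs M = (\<lambda>x. (x, p x)) ` {x\<in>{1..N}. x < p x}"
proof -
  note p = pairs_upD[OF assms]
  have "(i, j) \<in> arcs M \<longleftrightarrow> i \<in> {1..N} \<and> i < p i \<and> j = p i" for i j
  proof
    assume "(i, j) \<in> arcs M"
    then have "i < j" "{i, j} \<in> (\<lambda>x. {x, p x}) ` {1..N}"
      using assms by (auto simp: arcs_def pairs_up_def)
    then obtain x where x: "x \<in> {1..N}" "{i, j} = {x, p x}" by blast
    then show "i \<in> {1..N} \<and> i < p i \<and> j = p i"
      using p[OF x(1)] \<open>i < j\<close> by (auto simp: doubleton_eq_iff)
  next
    assume "i \<in> {1..N} \<and> i < p i \<and> j = p i"
    then show "(i, j) \<in> arcs M" using assms by (auto simp: arcs_def pairs_up_def)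
  qed
  then show ?thesis by auto
qed

lemma openers_pairs_up:
  assumes "pairs_up N p M"
  shows "openers M = {x\<in>{1..N}. x < p x}"
  unfolding openers_def arcs_pairs_up[OF assms] by force

lemma closers_pairs_up:
  assumes "pairs_up N p M"
  shows "closers M = {x\<in>{1..N}. p x < x}"
proof -
  note p = pairs_upD[OF assms]
  have "x \<in> p ` {y\<in>{1..N}. y < p y}" if "x \<in> {1..N}" "p x < x" for x
    using p[OF that(1)] that by (intro image_eqI[of _ _ "p x"]) auto
  moreover have "closers M = p ` {y\<in>{1..N}. y < p y}"
    unfolding closers_def arcs_pairs_up[OF assms] by force
  ultimately show ?thesis using p by auto
qed

text \<open>The partner map exchanges openers and closers.\<close>

lemma card_openers:
  assumes "pairs_up N p M"
  shows "2 * card {x\<in>{1..N}. x < p x} = N"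
proof -
  note p = pairs_upD[OF assms]
  let ?O = "{x\<in>{1..N}. x < p x}" and ?C = "{x\<in>{1..N}. p x < x}"
  have "?C = p ` ?O"
    unfolding closers_pairs_up[OF assms, symmetric] closers_def arcs_pairs_up[OF assms]
    by (simp add: image_image)
  moreover have "inj_on p ?O" using p(3) by (metis (mono_tags, lifting) inj_onI mem_Collect_eq)
  ultimately have "card ?C = card ?O" by (simp add: card_image)
  moreover have "{1..N} = ?O \<union> ?C" using p(2) by (blast elim: linorder_neqE_nat)
  then have "N = card (?O \<union> ?C)" by (metis card_atLeastAtMost diff_Suc_1)
  moreover have "card (?O \<union> ?C) = card ?O + card ?C" by (rule card_Un_disjoint) auto
  ultimately show ?thesis by simp
qed

text \<open>
  Two adjacent openers form a left-nesting, and two adjacent closers a right-nesting, precisely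
  when the partner map reverses their order; the remaining inequalities in the definition of
  a nesting hold automatically. So one condition on adjacent positions of equal type
  covers both kinds of neighbor nesting.
\<close>

lemma no_neighbor_nestings_iff:
  assumes "pairs_up N p M"
  shows "no_neighbor_nestings M \<longleftrightarrow>
    (\<forall>x. x \<in> {1..N} \<longrightarrow> Suc x \<in> {1..N} \<longrightarrow> (p x < x \<longleftrightarrow> p (Suc x) < Suc x) \<longrightarrow> p x < p (Suc x))"
    (is "_ \<longleftrightarrow> ?R")
proof
  note p = pairs_upD[OF assms] and a = arcs_pairs_up[OF assms]
  assume nn: "no_neighbor_nestings M"
  show ?R
  proof (intro allI impI)
    fix x assume x: "x \<in> {1..N}" and y: "Suc x \<in> {1..N}"
      and same: "p x < x \<longleftrightarrow> p (Suc x) < Suc x"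
    show "p x < p (Suc x)"
    proof (rule ccontr)
      assume "\<not> p x < p (Suc x)"
      moreover have "p x \<noteq> p (Suc x)" using p(3)[OF x] p(3)[OF y] by (metis n_not_Suc_n)
      ultimately have less: "p (Suc x) < p x" by simp
      show False
      proof (cases "p x < x")
        case True
        then have "p (Suc x) < p x" "(p (Suc x), Suc x) \<in> arcs M" "(p x, x) \<in> arcs M"
          using less same p[OF x] p[OF y] unfolding a by (auto simp: image_iff)
        then have "is_right_nesting M (p (Suc x), Suc x) (p x, x)"
          using True by (auto simp: is_right_nesting_def is_nesting_def)
        then show False using nn by (auto simp: no_neighbor_nestings_def)
      next
        case False
        then have "x < p x" "Suc x < p (Suc x)" using same p(2)[OF x] p(2)[OF y] by auto
        then have "is_left_nesting M (x, p x) (Suc x, p (Suc x))"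
          using less x y unfolding is_left_nesting_def is_nesting_def a by auto
        then show False using nn by (auto simp: no_neighbor_nestings_def)
      qed
    qed
  qed
next
  note p = pairs_upD[OF assms] and a = arcs_pairs_up[OF assms]
  assume R: ?R
  have False if "is_left_nesting M u v" for u v
  proof -
    obtain i l j k where uv: "u = (i, l)" "v = (j, k)" by fastforce
    show False using that R[rule_format, of i] unfolding uv is_left_nesting_def is_nesting_def a by auto
  qed
  moreover have False if "is_right_nesting M u v" for u v
  proof -
    obtain i l j k where uv: "u = (i, l)" "v = (j, k)" by fastforce
    show False
      using that R[rule_format, of k] p(1,3)[of i] p(1,3)[of j]
      unfolding uv is_right_nesting_def is_nesting_def a by auto
  qed
  ultimately show "no_neighbor_nestings M" by (auto simp: no_neighbor_nestings_def)
qed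

section \<open>Block numberings\<close>

text \<open>
  Recognises a list as the sorted enumeration of its elements. Strict sortedness already implies
  that the key function is injective on them.
\<close>

lemma (in linorder) sorted_key_list_of_set_eqI:
  assumes "sorted_wrt (<) (map f xs)"
  shows "sorted_key_list_of_set f (set xs) = xs"
proof -
  have "distinct (map f xs)" "sorted (map f xs)" using assms by (simp_all add: strict_sorted_iff)
  then interpret folding_insort_key "(\<le>)" "(<)" "set xs" f
    by unfold_locales (simp add: distinct_map)
  show ?thesis
    using \<open>distinct (map f xs)\<close> \<open>sorted (map f xs)\<close>
    by (intro idem_if_sorted_distinct) (simp_all add: distinct_map)
qed

text \<open>
  The maximal intervals of a set are the fibres of any function that is monotone on the set,
  takes an initial segment of values, and is constant exactly on the gap-free stretches.
  This lets the intervals be computed without looking at maximality again.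
\<close>

lemma interval_list_eq_map:
  fixes f :: "nat \<Rightarrow> nat"
  assumes fin: "finite S" and im: "f ` S = {..<k}"
    and mono: "\<And>x y. x \<in> S \<Longrightarrow> y \<in> S \<Longrightarrow> x \<le> y \<Longrightarrow> f x \<le> f y"
    and conn: "\<And>x y. x \<in> S \<Longrightarrow> y \<in> S \<Longrightarrow> x \<le> y \<Longrightarrow> f x = f y \<longleftrightarrow> {x..y} \<subseteq> S"
  shows "interval_list S = map (\<lambda>i. {x\<in>S. f x = i}) [0..<k]"
proof -
  define I where "I i = {x\<in>S. f x = i}" for i
  have finI: "finite (I i)" for i using fin by (simp add: I_def)
  have ne: "I i \<noteq> {}" if "i < k" for i
  proof -
    have "i \<in> f ` S" using im that by simp
    then show ?thesis by (auto simp: I_def)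
  qed
  have MinI: "Min (I i) \<in> S" "f (Min (I i)) = i" if "i < k" for i
    using Min_in[OF finI ne[OF that]] by (auto simp: I_def)
  have MaxI: "Max (I i) \<in> S" "f (Max (I i)) = i" if "i < k" for i
    using Max_in[OF finI ne[OF that]] by (auto simp: I_def)
  have int: "I i = {Min (I i)..Max (I i)}" if i: "i < k" for i
  proof
    show "I i \<subseteq> {Min (I i)..Max (I i)}" using finI by auto
    show "{Min (I i)..Max (I i)} \<subseteq> I i"
    proof
      fix z assume z: "z \<in> {Min (I i)..Max (I i)}"
      have le: "Min (I i) \<le> Max (I i)" using z by simp
      have "{Min (I i)..Max (I i)} \<subseteq> S"
        using conn[OF MinI(1)[OF i] MaxI(1)[OF i] le] MinI(2)[OF i] MaxI(2)[OF i] by simp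
      then have zS: "z \<in> S" using z by blast
      moreover have "f z = i"
        using mono[OF MinI(1)[OF i] zS] mono[OF zS MaxI(1)[OF i]] MinI(2)[OF i] MaxI(2)[OF i] z
        by simp
      ultimately show "z \<in> I i" by (simp add: I_def)
    qed
  qed
  have const: "f x = f y" if "{a..b} \<subseteq> S" "x \<in> {a..b}" "y \<in> {a..b}" for a b x y
  proof -
    have "f x = f y" if h: "x \<in> {a..b}" "y \<in> {a..b}" "x \<le> y" for x y
    proof -
      have "{x..y} \<subseteq> S" using \<open>{a..b} \<subseteq> S\<close> h by force
      moreover have "x \<in> S" "y \<in> S" using \<open>{a..b} \<subseteq> S\<close> h by auto
      ultimately show ?thesis using conn h(3) by blast
    qed
    then show ?thesis using that by (metis nat_le_linear)
  qed
  have max: "maximal_intervals S = I ` {..<k}"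
  proof
    show "I ` {..<k} \<subseteq> maximal_intervals S"
    proof
      fix J assume "J \<in> I ` {..<k}"
      then obtain i where i: "i < k" and J: "J = I i" by auto
      have "{a..b} = I i" if "I i \<subseteq> {a..b}" "{a..b} \<subseteq> S" for a b
      proof
        have m: "Min (I i) \<in> {a..b}" using Min_in[OF finI ne[OF i]] that by blast
        show "{a..b} \<subseteq> I i"
          using const[OF that(2) _ m] that(2) MinI(2)[OF i] by (auto simp: I_def)
      qed (use that in auto)
      moreover have "\<exists>a b. I i = {a..b}" using int[OF i] by blast
      ultimately show "J \<in> maximal_intervals S"
        using ne[OF i] by (auto simp: maximal_intervals_def J I_def)
    qed
    show "maximal_intervals S \<subseteq> I ` {..<k}"
    proof
      fix J assume "J \<in> maximal_intervals S"
      then have "J \<noteq> {}" "\<exists>a b. J = {a..b}" "J \<subseteq> S"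
        and mx: "\<forall>c d. J \<subseteq> {c..d} \<longrightarrow> {c..d} \<subseteq> S \<longrightarrow> {c..d} = J"
        unfolding maximal_intervals_def mem_Collect_eq by simp_all
      then obtain a b where J: "J = {a..b}" "J \<noteq> {}" "J \<subseteq> S" by metis
      have ab: "a \<in> {a..b}" using J(1,2) by simp
      then have a: "a \<in> {a..b}" "a \<in> S" using J(3) unfolding J(1) by (simp_all only: subsetD)
      have i: "f a < k" using imageI[OF a(2), of f] im by simp
      have "J \<subseteq> I (f a)"
      proof
        fix z assume "z \<in> J"
        then show "z \<in> I (f a)" using const[of a b z a] J(3) ab unfolding J(1) I_def by blast
      qed
      moreover have "I (f a) \<subseteq> S" by (auto simp: I_def)
      ultimately have "I (f a) = J"
        using mx[rule_format, of "Min (I (f a))" "Max (I (f a))"] int[OF i] by simp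
      then show "J \<in> I ` {..<k}" using i by blast
    qed
  qed
  have less: "Min (I i) < Min (I j)" if "i < j" "j < k" for i j
  proof (rule ccontr)
    assume "\<not> Min (I i) < Min (I j)"
    then have "j \<le> i" using mono[of "Min (I j)" "Min (I i)"] MinI[of i] MinI[of j] that by auto
    then show False using that by simp
  qed
  have "sorted_wrt (<) (map Min (map I [0..<k]))"
    using less by (auto simp: sorted_wrt_iff_nth_less)
  then have "sorted_key_list_of_set Min (set (map I [0..<k])) = map I [0..<k]"
    by (rule sorted_key_list_of_set_eqI)
  moreover have "set (map I [0..<k]) = maximal_intervals S"
    by (simp add: max atLeast0LessThan)
  ultimately have "sorted_key_list_of_set Min (maximal_intervals S) = map I [0..<k]" by simp
  then show ?thesis by (simp add: interval_list_def I_def)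
qed

text \<open>
  Axiomatic form of cutting a matching after each closer that is followed by an opener: the
  blocks are consecutive, in each block no opener follows a closer, and the blocks containing
  openers as well as those containing closers are exactly those numbered \<open>0, \<dots>, k - 1\<close>. It is
  satisfied both by the numbering that counts the cuts and by the one read off from half-arcs.
\<close>

definition block_numbering :: "nat \<Rightarrow> (nat \<Rightarrow> nat) \<Rightarrow> nat \<Rightarrow> (nat \<Rightarrow> nat) \<Rightarrow> bool" where
  "block_numbering N p k \<beta> \<longleftrightarrow>
     (\<forall>x\<in>{1..N}. \<forall>y\<in>{1..N}. x \<le> y \<longrightarrow>
        \<beta> x \<le> \<beta> y \<and> (\<beta> x = \<beta> y \<longrightarrow> p x < x \<longrightarrow> p y < y)) \<and>
     \<beta> ` {x\<in>{1..N}. x < p x} = {..<k} \<and> \<beta> ` {x\<in>{1..N}. p x < x} = {..<k}"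

lemma block_numberingD:
  assumes "block_numbering N p k \<beta>"
  shows "\<And>x y. x \<in> {1..N} \<Longrightarrow> y \<in> {1..N} \<Longrightarrow> x \<le> y \<Longrightarrow> \<beta> x \<le> \<beta> y"
    and "\<And>x y. x \<in> {1..N} \<Longrightarrow> y \<in> {1..N} \<Longrightarrow> x \<le> y \<Longrightarrow> \<beta> x = \<beta> y \<Longrightarrow> p x < x \<Longrightarrow> p y < y"
    and "\<beta> ` {x\<in>{1..N}. x < p x} = {..<k}"
    and "\<beta> ` {x\<in>{1..N}. p x < x} = {..<k}"
    and "\<And>i. i < k \<Longrightarrow> \<exists>x\<in>{1..N}. x < p x \<and> \<beta> x = i"
    and "\<And>i. i < k \<Longrightarrow> \<exists>x\<in>{1..N}. p x < x \<and> \<beta> x = i"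
proof -
  show 3: "\<beta> ` {x\<in>{1..N}. x < p x} = {..<k}" and 4: "\<beta> ` {x\<in>{1..N}. p x < x} = {..<k}"
    using assms by (simp_all add: block_numbering_def)
  show "\<exists>x\<in>{1..N}. x < p x \<and> \<beta> x = i" if "i < k" for i
  proof -
    have "i \<in> \<beta> ` {x\<in>{1..N}. x < p x}" using 3 that by simp
    then show ?thesis by blast
  qed
  show "\<exists>x\<in>{1..N}. p x < x \<and> \<beta> x = i" if "i < k" for i
  proof -
    have "i \<in> \<beta> ` {x\<in>{1..N}. p x < x}" using 4 that by simp
    then show ?thesis by blast
  qed
qed (use assms in \<open>unfold block_numbering_def, blast+\<close>)

lemma block_numbering_less:
  assumes "pairs_up N p M" "block_numbering N p k \<beta>" "x \<in> {1..N}"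
  shows "\<beta> x < k"
proof (cases "x < p x")
  case True
  then have "\<beta> x \<in> \<beta> ` {x\<in>{1..N}. x < p x}" using assms(3) by blast
  then show ?thesis unfolding block_numberingD(3)[OF assms(2)] by simp
next
  case False
  then have "p x < x" using pairs_upD(2)[OF assms(1,3)] by simp
  then have "\<beta> x \<in> \<beta> ` {x\<in>{1..N}. p x < x}" using assms(3) by blast
  then show ?thesis unfolding block_numberingD(4)[OF assms(2)] by simp
qed

text \<open>
  Openers of the same block have only openers between them; openers of different blocks
  are separated by a closer of the earlier block.
\<close>

lemma interval_list_openers:
  assumes P: "pairs_up N p M" and B: "block_numbering N p k \<beta>"
  shows "interval_list (openers M) = map (\<lambda>i. {x\<in>openers M. \<beta> x = i}) [0..<k]"
proof (rule interval_list_eq_map)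
  note op = openers_pairs_up[OF P] and b = block_numberingD[OF B]
  show "finite (openers M)" "\<beta> ` openers M = {..<k}" using b(3) by (simp_all add: op)
  show "\<beta> x \<le> \<beta> y" if "x \<in> openers M" "y \<in> openers M" "x \<le> y" for x y
    using b(1) that by (auto simp: op)
  show "\<beta> x = \<beta> y \<longleftrightarrow> {x..y} \<subseteq> openers M"
    if x: "x \<in> openers M" and y: "y \<in> openers M" and "x \<le> y" for x y
  proof
    assume eq: "\<beta> x = \<beta> y"
    show "{x..y} \<subseteq> openers M"
    proof
      fix z assume z: "z \<in> {x..y}"
      have zN: "z \<in> {1..N}" using x y z by (auto simp: op)
      then have "\<beta> z = \<beta> y" using b(1)[of x z] b(1)[of z y] x y z eq by (auto simp: op)
      then have "\<not> p z < z" using b(2)[OF zN, of y] y z by (auto simp: op)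
      then show "z \<in> openers M" using pairs_upD(2)[OF P zN] zN by (simp add: op)
    qed
  next
    assume sub: "{x..y} \<subseteq> openers M"
    show "\<beta> x = \<beta> y"
    proof (rule ccontr)
      assume "\<beta> x \<noteq> \<beta> y"
      then have less: "\<beta> x < \<beta> y" using b(1) x y \<open>x \<le> y\<close> by (simp add: op le_neq_implies_less)
      have "\<beta> x < k" using block_numbering_less[OF P B] x by (simp add: op)
      then obtain c where c: "c \<in> {1..N}" "p c < c" "\<beta> c = \<beta> x" using b(6) by blast
      have "x \<le> c" using b(2)[of c x] c x by (cases "c \<le> x") (auto simp: op)
      moreover have "c \<le> y" using b(1)[of y c] c y less by (cases "y \<le> c") (auto simp: op)
      ultimately show False using sub c by (auto simp: op)
    qed
  qed
qed

text \<open>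
  The mirror image of the previous lemma: closers of different blocks are separated by an opener
  of the later block.
\<close>

lemma interval_list_closers:
  assumes P: "pairs_up N p M" and B: "block_numbering N p k \<beta>"
  shows "interval_list (closers M) = map (\<lambda>i. {x\<in>closers M. \<beta> x = i}) [0..<k]"
proof (rule interval_list_eq_map)
  note cl = closers_pairs_up[OF P] and b = block_numberingD[OF B]
  show "finite (closers M)" "\<beta> ` closers M = {..<k}" using b(4) by (simp_all add: cl)
  show "\<beta> x \<le> \<beta> y" if "x \<in> closers M" "y \<in> closers M" "x \<le> y" for x y
    using b(1) that by (auto simp: cl)
  show "\<beta> x = \<beta> y \<longleftrightarrow> {x..y} \<subseteq> closers M"
    if x: "x \<in> closers M" and y: "y \<in> closers M" and "x \<le> y" for x y
  proof
    assume eq: "\<beta> x = \<beta> y"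
    show "{x..y} \<subseteq> closers M"
    proof
      fix z assume z: "z \<in> {x..y}"
      have zN: "z \<in> {1..N}" using x y z by (auto simp: cl)
      then have "\<beta> x = \<beta> z" using b(1)[of x z] b(1)[of z y] x y z eq by (auto simp: cl)
      then have "p z < z" using b(2)[OF _ zN, of x] x z by (auto simp: cl)
      then show "z \<in> closers M" using zN by (simp add: cl)
    qed
  next
    assume sub: "{x..y} \<subseteq> closers M"
    show "\<beta> x = \<beta> y"
    proof (rule ccontr)
      assume "\<beta> x \<noteq> \<beta> y"
      then have less: "\<beta> x < \<beta> y" using b(1) x y \<open>x \<le> y\<close> by (simp add: cl le_neq_implies_less)
      have "\<beta> y < k" using block_numbering_less[OF P B] y by (simp add: cl)
      then obtain c where c: "c \<in> {1..N}" "c < p c" "\<beta> c = \<beta> y" using b(5) by blast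
      have "c \<le> y" using b(2)[of y c] c y by (cases "y \<le> c") (auto simp: cl)
      moreover have "x \<le> c" using b(1)[of c x] c x less by (cases "c \<le> x") (auto simp: cl)
      ultimately show False using sub c by (auto simp: cl)
    qed
  qed
qed

lemma psi_block_numbering:
  assumes P: "pairs_up N p M" and B: "block_numbering N p k \<beta>"
  shows "psi M = mat k k (\<lambda>(i, j). card {x\<in>{1..N}. x < p x \<and> \<beta> x = i \<and> \<beta> (p x) = j})"
proof -
  have "card (arcs M \<inter> {x\<in>openers M. \<beta> x = i} \<times> {x\<in>closers M. \<beta> x = j})
      = card {x\<in>{1..N}. x < p x \<and> \<beta> x = i \<and> \<beta> (p x) = j}" for i j
  proof -
    have "arcs M \<inter> {x\<in>openers M. \<beta> x = i} \<times> {x\<in>closers M. \<beta> x = j}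
        = (\<lambda>x. (x, p x)) ` {x\<in>{1..N}. x < p x \<and> \<beta> x = i \<and> \<beta> (p x) = j}"
      using pairs_upD[OF P]
      unfolding arcs_pairs_up[OF P] openers_pairs_up[OF P] closers_pairs_up[OF P] by auto
    then show ?thesis by (simp add: card_image inj_on_def)
  qed
  then show ?thesis
    unfolding psi_def interval_list_openers[OF P B] interval_list_closers[OF P B] Let_def
    by (intro eq_matI) auto
qed

text \<open>
  Number each position by the number of cuts before it. A block begins at 1 or just after a cut,
  hence with an opener, and ends at a cut or at \<open>N\<close>, hence with a closer.
\<close>

lemma ex_block_numbering:
  assumes P: "pairs_up N p M" and "N \<ge> 1"
  obtains k \<beta> where "block_numbering N p k \<beta>"
proof -
  note p = pairs_upD[OF P]
  define D where "D = {y\<in>{1..<N}. p y < y \<and> Suc y < p (Suc y)}"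
  define \<beta> where "\<beta> x = card {y\<in>D. y < x}" for x
  define k where "k = Suc (\<beta> N)"
  have finD: "finite {y\<in>D. y < x}" for x by (simp add: D_def)
  have mono: "\<beta> x \<le> \<beta> y" if "x \<le> y" for x y
    unfolding \<beta>_def using that by (intro card_mono finD) auto
  have \<beta>_Suc: "\<beta> (Suc x) = (if x \<in> D then Suc (\<beta> x) else \<beta> x)" for x
  proof -
    have "{y\<in>D. y < Suc x} = (if x \<in> D then insert x {y\<in>D. y < x} else {y\<in>D. y < x})"
      by (auto simp: less_Suc_eq)
    then show ?thesis using finD[of x] by (simp add: \<beta>_def)
  qed
  have "\<beta> 1 = 0" by (auto simp: \<beta>_def D_def)
  \<comment> \<open>Without a cut in between, a closer is followed by closers only.\<close>
  have closed: "p y < y" if "x \<in> {1..N}" "x \<le> y" "y \<in> {1..N}" "\<beta> x = \<beta> y" "p x < x" for x y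
    using that(2-)
  proof (induction y rule: dec_induct)
    case (step y)
    have y: "y \<in> {1..N}" using that(1) step by auto
    have eq: "\<beta> x = \<beta> y" using mono[of x y] mono[of y "Suc y"] step by simp
    then have "p y < y" using step y by blast
    moreover have "y \<notin> D" using \<beta>_Suc[of y] eq step.prems by (auto split: if_splits)
    ultimately have "\<not> Suc y < p (Suc y)" using y step by (auto simp: D_def)
    then show ?case using p(2)[of "Suc y"] step by simp
  qed
  have opener: "\<exists>x\<in>{1..N}. x < p x \<and> \<beta> x = i" if "i < k" for i
  proof -
    \<comment> \<open>The first position of block i; by minimality the position before it is a cut.\<close>
    define x where "x = (LEAST x. 1 \<le> x \<and> i \<le> \<beta> x)"
    have iN: "1 \<le> N \<and> i \<le> \<beta> N" using that assms by (simp add: k_def)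
    then have x: "1 \<le> x" "i \<le> \<beta> x" "x \<le> N"
      unfolding x_def by (metis (mono_tags, lifting) LeastI Least_le)+
    have before: "\<beta> z < i" if "1 \<le> z" "z < x" for z
      using that not_less_Least[of z "\<lambda>x. 1 \<le> x \<and> i \<le> \<beta> x"] by (auto simp: x_def)
    show ?thesis
    proof (cases "x = 1")
      case True
      then have "x < p x" using p(1,2)[of x] x by auto
      then show ?thesis using x True \<open>\<beta> 1 = 0\<close> by auto
    next
      case False
      then obtain z where z: "x = Suc z" "1 \<le> z" using x by (cases x) auto
      then have "\<beta> z < i" using before by simp
      then have "z \<in> D" "\<beta> x = i" using x \<beta>_Suc[of z] z by (auto split: if_splits)
      then show ?thesis using x z by (auto simp: D_def)
    qed
  qed
  have closer: "\<exists>x\<in>{1..N}. p x < x \<and> \<beta> x = i" if i: "i < k" for i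
  proof -
    obtain x where x: "x \<in> {1..N}" "\<beta> x = i" using opener[OF i] by blast
    \<comment> \<open>The last position of block i, which is a cut unless it is N.\<close>
    define y where "y = Max {y\<in>{1..N}. \<beta> y = i}"
    have "y \<in> {y\<in>{1..N}. \<beta> y = i}" unfolding y_def using x by (intro Max_in) auto
    then have y: "y \<in> {1..N}" "\<beta> y = i" by auto
    show ?thesis
    proof (cases "y = N")
      case True
      then have "p y < y" using p(1,2)[OF y(1)] by auto
      then show ?thesis using y by blast
    next
      case False
      then have "Suc y \<in> {1..N}" using y by auto
      moreover have "z \<le> y" if "z \<in> {1..N}" "\<beta> z = i" for z
        unfolding y_def using that by (intro Max_ge) auto
      ultimately have "\<beta> (Suc y) \<noteq> i" by fastforce
      then have "y \<in> D" using \<beta>_Suc[of y] y by (auto split: if_splits)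
      then show ?thesis using y by (auto simp: D_def)
    qed
  qed
  have "\<beta> x < k" if "x \<in> {1..N}" for x using mono[of x N] that by (simp add: k_def)
  then have "\<beta> ` {x\<in>{1..N}. x < p x} \<subseteq> {..<k}" "\<beta> ` {x\<in>{1..N}. p x < x} \<subseteq> {..<k}"
    by auto
  moreover have "{..<k} \<subseteq> \<beta> ` {x\<in>{1..N}. x < p x}" using opener by fastforce
  moreover have "{..<k} \<subseteq> \<beta> ` {x\<in>{1..N}. p x < x}" using closer by fastforce
  moreover have "\<forall>x\<in>{1..N}. \<forall>y\<in>{1..N}. x \<le> y \<longrightarrow>
      \<beta> x \<le> \<beta> y \<and> (\<beta> x = \<beta> y \<longrightarrow> p x < x \<longrightarrow> p y < y)"
    using mono closed by simp
  ultimately have "block_numbering N p k \<beta>"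
    unfolding block_numbering_def by (intro conjI equalityI)
  then show thesis by (rule that)
qed

section \<open>Half-arcs of a matrix\<close>

text \<open>
  A half-arc \<open>(i, c, j, m)\<close> lies in block \<open>i\<close>, is a closer iff \<open>c\<close>, and has its partner in
  block \<open>j\<close>; \<open>m\<close> numbers the arcs between these two runs. Since \<open>False < True\<close>, the
  lexicographic order on these tuples is the order from left to right.
\<close>

type_synonym half_arc = "nat \<times> bool \<times> nat \<times> nat"

definition half_arcs :: "nat mat \<Rightarrow> half_arc set" where
  "half_arcs A = {(i, c, j, m).
     (if c then j < dim_row A \<and> i < dim_col A \<and> m < A $$ (j, i)
      else i < dim_row A \<and> j < dim_col A \<and> m < A $$ (i, j))}"

fun twin :: "half_arc \<Rightarrow> half_arc" where
  "twin (i, c, j, m) = (j, \<not> c, i, m)"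

lemma twin_twin [simp]: "twin (twin h) = h"
  by (cases h) simp

lemma twin_neq [simp]: "twin h \<noteq> h"
  by (cases h) simp

lemma twin_in_half_arcs_iff [simp]: "twin h \<in> half_arcs A \<longleftrightarrow> h \<in> half_arcs A"
  by (cases h) (simp add: half_arcs_def)

text \<open>Each unit of an entry contributes one opener half, and \<open>twin\<close> turns it into its closer half.\<close>

lemma finite_card_half_arcs:
  shows finite_half_arcs: "finite (half_arcs A)"
    and card_half_arcs: "card (half_arcs A) = 2 * sum_mat A"
proof -
  define K where
    "K = (\<lambda>((i, j), m). (i, False, j, m)) ` (SIGMA (i, j):{0..<dim_row A} \<times> {0..<dim_col A}. {..<A $$ (i, j)})"
  have "inj_on (\<lambda>((i, j), m). (i, False, j, m)) X" for X :: "((nat \<times> nat) \<times> nat) set"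
    by (auto simp: inj_on_def)
  then have cardK: "card K = sum_mat A"
    by (simp add: K_def card_image sum_mat_def split_def)
  have finK: "finite K" by (auto simp: K_def)
  have "half_arcs A = K \<union> twin ` K"
  proof
    show "half_arcs A \<subseteq> K \<union> twin ` K"
    proof
      fix h assume h: "h \<in> half_arcs A"
      obtain i c j m where hd: "h = (i, c, j, m)" by (metis prod_cases4)
      show "h \<in> K \<union> twin ` K"
      proof (cases c)
        case False
        then show ?thesis using h unfolding hd half_arcs_def K_def by force
      next
        case True
        then have "twin h \<in> K" using h unfolding hd half_arcs_def K_def by force
        then show ?thesis using twin_twin[of h] by (metis UnI2 imageI)
      qed
    qed
    have "K \<subseteq> half_arcs A" by (auto simp: K_def half_arcs_def)
    moreover from this have "twin ` K \<subseteq> half_arcs A"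
      using twin_in_half_arcs_iff by blast
    ultimately show "K \<union> twin ` K \<subseteq> half_arcs A" by blast
  qed
  moreover have "K \<inter> twin ` K = {}" by (auto simp: K_def)
  moreover have "inj_on twin K" by (metis inj_onI twin_twin)
  ultimately show "finite (half_arcs A)" "card (half_arcs A) = 2 * sum_mat A"
    using finK cardK by (simp_all add: card_Un_disjoint card_image)
qed

text \<open>
  Upper triangularity is what makes the half flagged as a closer come after its twin: the
  block of an opener is at most that of its closer, and on the diagonal the flag decides.
\<close>

lemma half_arc_less_twin_iff:
  assumes "upper_triangular A" "h \<in> half_arcs A"
  shows "twin h < h \<longleftrightarrow> fst (snd h)"
proof -
  obtain i c j m where hd: "h = (i, c, j, m)" by (metis prod_cases4)
  have "\<not> j' < i'" if "i' < dim_row A" "m < A $$ (i', j')" for i' j'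
    using upper_triangularD[OF assms(1), of j' i'] that by auto
  then show ?thesis using assms(2) by (cases c) (auto simp: hd half_arcs_def not_less le_less)
qed

lemma T_D:
  assumes "A \<in> T n"
  shows "dim_col A = dim_row A" "upper_triangular A" "sum_mat A = n"
    and "\<And>i. i < dim_row A \<Longrightarrow> \<exists>j < dim_row A. 0 < A $$ (i, j)"
    and "\<And>j. j < dim_row A \<Longrightarrow> \<exists>i < dim_row A. 0 < A $$ (i, j)"
proof -
  show sq: "dim_col A = dim_row A" and "upper_triangular A" "sum_mat A = n"
    using assms by (auto simp: T_def)
  show "\<exists>j < dim_row A. 0 < A $$ (i, j)" if "i < dim_row A" for i
  proof -
    have "row A i \<noteq> 0\<^sub>v (dim_col A)" using assms that by (auto simp: T_def)
    then show ?thesis using that sq by (auto simp: vec_eq_iff)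
  qed
  show "\<exists>i < dim_row A. 0 < A $$ (i, j)" if "j < dim_row A" for j
  proof -
    have "col A j \<noteq> 0\<^sub>v (dim_row A)" using assms that sq by (auto simp: T_def)
    then show ?thesis using that sq by (auto simp: vec_eq_iff)
  qed
qed

text \<open>Nonvanishing rows and columns provide every block with an opener and with a closer.\<close>

lemma half_arcs_flag_exists:
  assumes "A \<in> T n" "i < dim_row A"
  shows "\<exists>j m. (i, c, j, m) \<in> half_arcs A"
  using T_D[OF assms(1)] assms(2) by (cases c) (force simp: half_arcs_def)+

section \<open>Labelling positions by half-arcs\<close>

text \<open>
  The labelling \<open>g\<close> is the order isomorphism from positions to half-arcs; under it the partner
  map becomes \<open>twin\<close>. This relation is the link between matchings and matrices.
\<close>

definition labels :: "nat \<Rightarrow> (nat \<Rightarrow> nat) \<Rightarrow> nat mat \<Rightarrow> (nat \<Rightarrow> half_arc) \<Rightarrow> bool" where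
  "labels N p A g \<longleftrightarrow>
     (\<forall>x\<in>{1..N}. \<forall>y\<in>{1..N}. x < y \<longrightarrow> g x < g y) \<and>
     g ` {1..N} = half_arcs A \<and> (\<forall>x\<in>{1..N}. g (p x) = twin (g x))"

lemma labelsD:
  assumes "labels N p A g"
  shows "\<And>x y. x \<in> {1..N} \<Longrightarrow> y \<in> {1..N} \<Longrightarrow> g x < g y \<longleftrightarrow> x < y"
    and "g ` {1..N} = half_arcs A"
    and "\<And>x. x \<in> {1..N} \<Longrightarrow> g (p x) = twin (g x)"
    and "\<And>x. x \<in> {1..N} \<Longrightarrow> g x \<in> half_arcs A"
    and "inj_on g {1..N}"
proof -
  have m: "x \<in> {1..N} \<Longrightarrow> y \<in> {1..N} \<Longrightarrow> x < y \<Longrightarrow> g x < g y" for x y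
    using assms by (simp add: labels_def)
  show less: "g x < g y \<longleftrightarrow> x < y" if "x \<in> {1..N}" "y \<in> {1..N}" for x y
    using m that by (metis not_less_iff_gr_or_eq)
  show "inj_on g {1..N}" using less by (metis inj_onI less_irrefl linorder_neqE_nat)
  show im: "g ` {1..N} = half_arcs A" using assms by (simp add: labels_def)
  show "g (p x) = twin (g x)" if "x \<in> {1..N}" for x using assms that by (simp add: labels_def)
  show "g x \<in> half_arcs A" if "x \<in> {1..N}" for x using im that by blast
qed

text \<open>
  Both labellings enumerate the same finite linearly ordered set increasingly.
\<close>

lemma labels_unique:
  assumes "labels N p A g" "labels N q A h" "x \<in> {1..N}"
  shows "g x = h x"
proof -
  have "map g [1..<Suc N] = sorted_list_of_set (half_arcs A)" if "labels N p A g" for p g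
  proof -
    note l = labelsD[OF that]
    have "sorted_wrt (<) (map g [1..<Suc N])"
      using l(1) by (auto simp: sorted_wrt_iff_nth_less simp del: upt_Suc)
    moreover have "set (map g [1..<Suc N]) = half_arcs A"
      unfolding l(2)[symmetric] set_map set_upt by (simp add: atLeastLessThanSuc_atLeastAtMost)
    ultimately show ?thesis
      by (metis sorted_list_of_set.idem_if_sorted_distinct strict_sorted_iff)
  qed
  then have "map g [1..<Suc N] = map h [1..<Suc N]" using assms by metis
  then show ?thesis using assms(3) by (simp del: upt_Suc)
qed

text \<open>
  The labelling is the sorted list of half-arcs, shifted by one because positions start at 1, and the
  partner map is \<open>twin\<close> transported along it.
\<close>

lemma ex_labels:
  assumes "A \<in> T n"
  obtains p M g where "pairs_up (2 * n) p M" "labels (2 * n) p A g"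
proof -
  define N where "N = 2 * n"
  define xs where "xs = sorted_list_of_set (half_arcs A)"
  define g where "g x = xs ! (x - 1)" for x
  have len: "length xs = N"
    using T_D(3)[OF assms] by (simp add: xs_def N_def card_half_arcs)
  have srt: "sorted_wrt (<) xs" by (simp add: xs_def)
  have less: "g x < g y" if "x \<in> {1..N}" "y \<in> {1..N}" "x < y" for x y
    using sorted_wrt_nth_less[OF srt, of "x - 1" "y - 1"] that len by (auto simp: g_def)
  have inj: "inj_on g {1..N}"
    using less by (metis inj_onI less_irrefl linorder_neqE_nat)
  have "g ` {1..N} \<subseteq> half_arcs A"
  proof
    fix h assume "h \<in> g ` {1..N}"
    then obtain x where "x \<in> {1..N}" "h = g x" by blast
    then have "x - 1 < length xs" "h = xs ! (x - 1)" using len by (auto simp: g_def)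
    then have "h \<in> set xs" by simp
    then show "h \<in> half_arcs A" by (simp add: xs_def finite_half_arcs)
  qed
  moreover have "card (g ` {1..N}) = card (half_arcs A)"
    using inj T_D(3)[OF assms] by (simp add: card_image card_half_arcs N_def)
  ultimately have im: "g ` {1..N} = half_arcs A" by (intro card_subset_eq finite_half_arcs)
  define p where "p x = the_inv_into {1..N} g (twin (g x))" for x
  have tw: "twin (g x) \<in> g ` {1..N}" if "x \<in> {1..N}" for x
    using that im by (metis imageI twin_in_half_arcs_iff)
  have gp: "g (p x) = twin (g x)" if "x \<in> {1..N}" for x
    using f_the_inv_into_f[OF inj tw[OF that]] by (simp add: p_def)
  have rng: "p x \<in> {1..N}" if "x \<in> {1..N}" for x
    using the_inv_into_into[OF inj tw[OF that] subset_refl] by (simp add: p_def)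
  have "p x \<noteq> x" if "x \<in> {1..N}" for x using gp[OF that] by (metis twin_neq)
  moreover have "p (p x) = x" if "x \<in> {1..N}" for x
    using inj_onD[OF inj, of "p (p x)" x] gp[OF that] gp[OF rng[OF that]] rng that by simp
  ultimately have "pairs_up N p ((\<lambda>x. {x, p x}) ` {1..N})"
    unfolding pairs_up_def using rng by blast
  moreover have "labels N p A g"
    unfolding labels_def using less im gp by blast
  ultimately show thesis using that unfolding N_def by blast
qed

lemma labels_closer_iff:
  assumes "A \<in> T n" "pairs_up N p M" "labels N p A g" "x \<in> {1..N}"
  shows "fst (snd (g x)) \<longleftrightarrow> p x < x"
  using labelsD[OF assms(3)] half_arc_less_twin_iff[OF T_D(2)[OF assms(1)]]
    pairs_upD(1)[OF assms(2)] assms(4) by metis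

lemma labels_block_numbering:
  assumes A: "A \<in> T n" and P: "pairs_up N p M" and L: "labels N p A g"
  shows "block_numbering N p (dim_row A) (fst \<circ> g)"
proof -
  note l = labelsD[OF L] and c = labels_closer_iff[OF A P L]
  have sq: "dim_col A = dim_row A" using T_D(1)[OF A] .
  have le: "g x \<le> g y" if "x \<in> {1..N}" "y \<in> {1..N}" "x \<le> y" for x y
    using l(1)[OF that(1,2)] that(3) by (cases "x = y") auto
  have mono: "fst (g x) \<le> fst (g y)" if "x \<in> {1..N}" "y \<in> {1..N}" "x \<le> y" for x y
    using le[OF that] by (cases "g x"; cases "g y") auto
  have block: "p y < y"
    if "x \<in> {1..N}" "y \<in> {1..N}" "x \<le> y" "fst (g x) = fst (g y)" "p x < x" for x y
    using le[OF that(1-3)] that(4,5) c[OF that(1)] c[OF that(2)]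
    by (cases "g x"; cases "g y") auto
  have bound: "fst (g x) < dim_row A" if "x \<in> {1..N}" for x
    using l(4)[OF that] sq by (cases "g x") (auto simp: half_arcs_def split: if_splits)
  have ex: "\<exists>x\<in>{1..N}. (p x < x \<longleftrightarrow> b) \<and> fst (g x) = i" if i: "i < dim_row A" for i b
  proof -
    obtain j m where "(i, b, j, m) \<in> g ` {1..N}" using half_arcs_flag_exists[OF A i] l(2) by metis
    then obtain x where "x \<in> {1..N}" "g x = (i, b, j, m)" by (metis imageE)
    then show ?thesis using c[of x] by auto
  qed
  have "(fst \<circ> g) ` {x\<in>{1..N}. x < p x} = {..<dim_row A}"
  proof
    show "{..<dim_row A} \<subseteq> (fst \<circ> g) ` {x\<in>{1..N}. x < p x}"
    proof
      fix i assume "i \<in> {..<dim_row A}"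
      then obtain x where "x \<in> {1..N}" "\<not> p x < x" "fst (g x) = i" using ex[of i False] by auto
      moreover from this have "x < p x" using pairs_upD(2)[OF P, of x] by simp
      ultimately show "i \<in> (fst \<circ> g) ` {x\<in>{1..N}. x < p x}" by force
    qed
  qed (use bound in auto)
  moreover have "(fst \<circ> g) ` {x\<in>{1..N}. p x < x} = {..<dim_row A}"
  proof
    show "{..<dim_row A} \<subseteq> (fst \<circ> g) ` {x\<in>{1..N}. p x < x}"
    proof
      fix i assume "i \<in> {..<dim_row A}"
      then obtain x where "x \<in> {1..N}" "p x < x" "fst (g x) = i" using ex[of i True] by auto
      then show "i \<in> (fst \<circ> g) ` {x\<in>{1..N}. p x < x}" by force
    qed
  qed (use bound in auto)
  ultimately show ?thesis
    unfolding block_numbering_def o_apply using mono block by blast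
qed

text \<open>
  The labelling carries the arcs from run \<open>i\<close> of openers to run \<open>j\<close> of closers bijectively to the
  half-arcs \<open>(i, False, j, m)\<close> with \<open>m < A $$ (i, j)\<close>.
\<close>

lemma labels_psi:
  assumes A: "A \<in> T n" and P: "pairs_up N p M" and L: "labels N p A g"
  shows "psi M = A"
proof -
  note l = labelsD[OF L] and c = labels_closer_iff[OF A P L]
  have sq: "dim_col A = dim_row A" using T_D(1)[OF A] .
  have "card {x\<in>{1..N}. x < p x \<and> fst (g x) = i \<and> fst (g (p x)) = j} = A $$ (i, j)"
    if ij: "i < dim_row A" "j < dim_row A" for i j
  proof -
    let ?X = "{x\<in>{1..N}. x < p x \<and> fst (g x) = i \<and> fst (g (p x)) = j}"
    have "g ` ?X = (\<lambda>m. (i, False, j, m)) ` {..<A $$ (i, j)}"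
    proof
      show "g ` ?X \<subseteq> (\<lambda>m. (i, False, j, m)) ` {..<A $$ (i, j)}"
      proof
        fix h assume "h \<in> g ` ?X"
        then obtain x where x: "x \<in> {1..N}" "x < p x" "fst (g x) = i" "fst (g (p x)) = j" "h = g x"
          by blast
        then show "h \<in> (\<lambda>m. (i, False, j, m)) ` {..<A $$ (i, j)}"
          using c[OF x(1)] l(3)[OF x(1)] l(4)[OF x(1)]
          by (cases "g x") (auto simp: half_arcs_def)
      qed
      show "(\<lambda>m. (i, False, j, m)) ` {..<A $$ (i, j)} \<subseteq> g ` ?X"
      proof
        fix h assume "h \<in> (\<lambda>m. (i, False, j, m)) ` {..<A $$ (i, j)}"
        then obtain m where h: "h = (i, False, j, m)" "m < A $$ (i, j)" by blast
        then have "h \<in> g ` {1..N}" using ij sq l(2) by (simp add: half_arcs_def)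
        then obtain x where x: "x \<in> {1..N}" "h = g x" by blast
        then have "\<not> p x < x" "fst (g x) = i" "fst (g (p x)) = j"
          unfolding c[OF x(1), symmetric] l(3)[OF x(1)] x(2)[symmetric] h by simp_all
        moreover from this have "x < p x" using pairs_upD(2)[OF P x(1)] by simp
        ultimately show "h \<in> g ` ?X" using x by (intro image_eqI[of _ _ x]) simp_all
      qed
    qed
    moreover have "card (g ` ?X) = card ?X"
      by (rule card_image, rule inj_on_subset[OF l(5)]) auto
    ultimately have "card ?X = card ((\<lambda>m. (i, False, j, m)) ` {..<A $$ (i, j)})" by simp
    then show ?thesis by (simp add: card_image inj_on_def)
  qed
  then show ?thesis
    unfolding psi_block_numbering[OF P labels_block_numbering[OF A P L]]
    by (intro eq_matI) (simp_all add: sq)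
qed

text \<open>
  Adjacent positions of equal type carry consecutive half-arcs. These lie in the same block, as
  otherwise a half-arc of the opposite type, a closer of the earlier or an opener of the later
  block, would come between them. In the same run, half-arcs are ordered by their last two
  components, and these decide the order of the twins as well.
\<close>

lemma labels_no_neighbor_nestings:
  assumes A: "A \<in> T n" and P: "pairs_up N p M" and L: "labels N p A g"
  shows "no_neighbor_nestings M"
  unfolding no_neighbor_nestings_iff[OF P]
proof (intro allI impI)
  note l = labelsD[OF L] and c = labels_closer_iff[OF A P L]
  fix x assume x: "x \<in> {1..N}" and y: "Suc x \<in> {1..N}"
    and same: "p x < x \<longleftrightarrow> p (Suc x) < Suc x"
  have gap: "\<not> (g x < h \<and> h < g (Suc x))" if h: "h \<in> half_arcs A" for h
  proof -
    have "h \<in> g ` {1..N}" using h l(2) by simp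
    then obtain z where "z \<in> {1..N}" "h = g z" by blast
    then show ?thesis using l(1) x y by auto
  qed
  obtain i b j m where gx: "g x = (i, b, j, m)" by (metis prod_cases4)
  obtain i' b' j' m' where gy: "g (Suc x) = (i', b', j', m')" by (metis prod_cases4)
  have b: "b' = b" using c[OF x] c[OF y] same gx gy by simp
  have less: "g x < g (Suc x)" using l(1)[OF x y] by simp
  have "i = i'"
  proof (rule ccontr)
    assume "i \<noteq> i'"
    then have ii: "i < i'" using less gx gy by (auto simp: le_less)
    have bound: "i < dim_row A" "i' < dim_row A"
      using l(4)[OF x] l(4)[OF y] T_D(1)[OF A] gx gy by (auto simp: half_arcs_def split: if_splits)
    show False
    proof (cases b)
      case False
      obtain r s where "(i, True, r, s) \<in> half_arcs A" using half_arcs_flag_exists[OF A bound(1)] by blast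
      then show False using gap[of "(i, True, r, s)"] False ii b gx gy by simp
    next
      case True
      obtain r s where "(i', False, r, s) \<in> half_arcs A" using half_arcs_flag_exists[OF A bound(2)] by blast
      then show False using gap[of "(i', False, r, s)"] True ii b gx gy by simp
    qed
  qed
  then have "twin (g x) < twin (g (Suc x))" using less gx gy b by auto
  then have "g (p x) < g (p (Suc x))" using l(3) x y by simp
  then show "p x < p (Suc x)" using l(1) pairs_upD(1)[OF P] x y by blast
qed

section \<open>Labelling a matching without neighbor nestings\<close>

text \<open>
  The condition on adjacent positions propagates through a whole run, because all positions between
  two members of a run belong to the run.
\<close>

lemma block_partner_mono:
  assumes P: "pairs_up N p M" and B: "block_numbering N p k \<beta>" and nn: "no_neighbor_nestings M"
    and "x \<in> {1..N}" "y \<in> {1..N}" "x < y" "\<beta> x = \<beta> y" "p x < x \<longleftrightarrow> p y < y"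
  shows "p x < p y"
  using assms(5-)
proof (induction y)
  case (Suc y)
  note b = block_numberingD[OF B]
  note step = nn[unfolded no_neighbor_nestings_iff[OF P], rule_format, of y]
  show ?case
  proof (cases "x = y")
    case True
    then show ?thesis using step Suc.prems assms(4) by simp
  next
    case False
    then have xy: "x < y" and y: "y \<in> {1..N}" using Suc.prems assms(4) by auto
    have eq: "\<beta> x = \<beta> y" "\<beta> y = \<beta> (Suc y)"
      using b(1)[OF assms(4) y] b(1)[OF y Suc.prems(1)] xy Suc.prems(3) by auto
    have type: "p x < x \<longleftrightarrow> p y < y" "p y < y \<longleftrightarrow> p (Suc y) < Suc y"
      using b(2)[OF assms(4) y] b(2)[OF y Suc.prems(1)] xy eq Suc.prems(4) by auto
    show ?thesis using Suc.IH[OF y xy eq(1) type(1)] step[OF y Suc.prems(1) type(2)] by simp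
  qed
qed simp

text \<open>
  Every block has an opener and a closer, whose arcs make the row and the column of that block
  nonzero. The entries sum to the number of openers, as they count the openers by the blocks of
  their two ends.
\<close>

lemma psi_in_T:
  assumes M: "is_matching (2 * n) M" and "n \<ge> 1"
  shows "psi M \<in> T n"
proof -
  obtain p where P: "pairs_up (2 * n) p M" using is_matching_imp_pairs_up[OF M] .
  obtain k \<beta> where B: "block_numbering (2 * n) p k \<beta>"
    using ex_block_numbering[OF P] assms(2) by auto
  note p = pairs_upD[OF P] and b = block_numberingD[OF B] and bk = block_numbering_less[OF P B]
  define N where "N = 2 * n"
  define X where "X i j = {x\<in>{1..N}. x < p x \<and> \<beta> x = i \<and> \<beta> (p x) = j}" for i j
  have psi: "psi M = mat k k (\<lambda>(i, j). card (X i j))"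
    using psi_block_numbering[OF P B] by (simp add: X_def N_def)
  have pos: "0 < card (X (\<beta> x) (\<beta> (p x)))" if "x \<in> {1..N}" "x < p x" for x
    using that by (auto simp: X_def card_gt_0_iff)
  have "card (X i j) = 0" if "j < i" for i j
  proof -
    have "\<beta> x \<le> \<beta> (p x)" if "x \<in> {1..N}" "x < p x" for x using b(1) p(1) that by (simp add: N_def)
    then have "X i j = {}" using that by (force simp: X_def)
    then show ?thesis by simp
  qed
  then have "upper_triangular (psi M)" unfolding psi by auto
  moreover have "row (psi M) i \<noteq> 0\<^sub>v k" if i: "i < k" for i
  proof
    assume z: "row (psi M) i = 0\<^sub>v k"
    obtain x where x: "x \<in> {1..N}" "x < p x" "\<beta> x = i" using b(5)[OF i] by (auto simp: N_def)
    then have j: "\<beta> (p x) < k" using bk p(1) by (simp add: N_def)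
    have "row (psi M) i $ \<beta> (p x) = 0" using z j by simp
    then show False using pos[OF x(1,2)] x(3) i j by (simp add: psi)
  qed
  moreover have "col (psi M) j \<noteq> 0\<^sub>v k" if j: "j < k" for j
  proof
    assume z: "col (psi M) j = 0\<^sub>v k"
    obtain y where y: "y \<in> {1..N}" "p y < y" "\<beta> y = j" using b(6)[OF j] by (auto simp: N_def)
    then have x: "p y \<in> {1..N}" "p (p y) = y" using p by (auto simp: N_def)
    then have i: "\<beta> (p y) < k" using bk by (simp add: N_def)
    have "col (psi M) j $ \<beta> (p y) = 0" using z i by simp
    then show False using pos[of "p y"] x y i j by (simp add: psi)
  qed
  moreover have "sum_mat (psi M) = n"
  proof -
    let ?O = "{x\<in>{1..N}. x < p x}" and ?R = "{0..<k} \<times> {0..<k}"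
    have "sum_mat (psi M) = (\<Sum>ij\<in>?R. card (X (fst ij) (snd ij)))"
      unfolding sum_mat_def psi by (intro sum.cong) auto
    also have "\<dots> = (\<Sum>ij\<in>?R. \<Sum>x\<in>{x\<in>?O. (\<beta> x, \<beta> (p x)) = ij}. 1)"
      by (intro sum.cong) (auto simp: X_def intro!: arg_cong[of _ _ card])
    also have "\<dots> = (\<Sum>x\<in>?O. 1)"
      using bk p(1) by (intro sum.group) (auto simp: N_def)
    also have "\<dots> = card ?O" by simp
    finally show ?thesis using card_openers[OF P] by (simp add: N_def)
  qed
  ultimately show ?thesis by (auto simp: T_def psi)
qed

text \<open>
  Label a position by its block, its type, the block of its partner, and its rank among the
  positions that agree with it in these three respects. Monotonicity of the partner map on
  runs enters twice: it makes the two ends of an arc have equal rank, so that they receive twin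
  labels, and it makes the labelling increasing. Surjectivity onto the half-arcs then follows
  by counting.
\<close>

lemma no_neighbor_nestings_imp_labels:
  assumes P: "pairs_up (2 * n) p M" and "n \<ge> 1" and nn: "no_neighbor_nestings M"
  obtains g where "labels (2 * n) p (psi M) g"
proof -
  define N where "N = 2 * n"
  have P: "pairs_up N p M" using P by (simp add: N_def)
  obtain k \<beta> where B: "block_numbering N p k \<beta>"
    using ex_block_numbering[OF P] assms(2) by (auto simp: N_def)
  note p = pairs_upD[OF P] and b = block_numberingD[OF B] and bk = block_numbering_less[OF P B]
  note pm = block_partner_mono[OF P B nn]
  define cls where
    "cls x = {y\<in>{1..N}. \<beta> y = \<beta> x \<and> (p y < y \<longleftrightarrow> p x < x) \<and> \<beta> (p y) = \<beta> (p x)}" for x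
  define rank where "rank x = card {y\<in>cls x. y < x}" for x
  define g where "g x = (\<beta> x, p x < x, \<beta> (p x), rank x)" for x
  have fin: "finite (cls x)" for x by (simp add: cls_def)
  have flip: "p (p x) < p x \<longleftrightarrow> \<not> p x < x" if "x \<in> {1..N}" for x
    using p(2,3)[OF that] by auto
  have rank_le: "rank x \<le> rank (p x)" if x: "x \<in> {1..N}" for x
    unfolding rank_def
  proof (rule card_inj_on_le[of p])
    show "inj_on p {y\<in>cls x. y < x}"
      using p(3) by (intro inj_onI) (metis (mono_tags, lifting) cls_def mem_Collect_eq)
    show "p ` {y\<in>cls x. y < x} \<subseteq> {y\<in>cls (p x). y < p x}"
    proof
      fix z assume "z \<in> p ` {y\<in>cls x. y < x}"
      then obtain y where y: "z = p y" "y \<in> cls x" "y < x" by blast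
      then have yN: "y \<in> {1..N}" by (simp add: cls_def)
      have "z \<in> cls (p x)"
        using y p(1,3)[OF yN] p(3)[OF x] flip[OF x] flip[OF yN] by (simp add: cls_def)
      moreover have "p y < p x" using pm[OF yN x y(3)] y(2) by (simp add: cls_def)
      ultimately show "z \<in> {y\<in>cls (p x). y < p x}" using y(1) by simp
    qed
  qed (use fin in simp)
  \<comment> \<open>The reverse inequality is the same statement for p x, as p is an involution.\<close>
  have rank_p: "rank (p x) = rank x" if "x \<in> {1..N}" for x
    using rank_le[OF that] rank_le[OF p(1)[OF that]] p(3)[OF that] by simp
  have gp: "g (p x) = twin (g x)" if "x \<in> {1..N}" for x
    using p(3)[OF that] flip[OF that] rank_p[OF that] by (simp add: g_def)
  have less: "g x < g y" if x: "x \<in> {1..N}" and y: "y \<in> {1..N}" and xy: "x < y" for x y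
  proof (cases "\<beta> x = \<beta> y \<and> (p x < x \<longleftrightarrow> p y < y)")
    case False
    have "\<beta> x \<le> \<beta> y" "\<beta> x = \<beta> y \<Longrightarrow> p x < x \<Longrightarrow> p y < y"
      using b(1,2)[OF x y] xy by auto
    then show ?thesis using False by (auto simp: g_def)
  next
    case True
    then have "p x < p y" using pm[OF x y xy] by blast
    then have le: "\<beta> (p x) \<le> \<beta> (p y)" using b(1) p(1) x y by simp
    have "rank x < rank y" if "\<beta> (p x) = \<beta> (p y)"
      unfolding rank_def
    proof (rule psubset_card_mono)
      have "cls x = cls y" using True that by (simp add: cls_def)
      moreover have "x \<in> cls x" using x by (simp add: cls_def)
      ultimately show "{z\<in>cls x. z < x} \<subset> {z\<in>cls y. z < y}" using xy by auto
    qed (use fin in simp)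
    then show ?thesis using True le by (auto simp: g_def le_less)
  qed
  have psi: "psi M = mat k k (\<lambda>(i, j). card {x\<in>{1..N}. x < p x \<and> \<beta> x = i \<and> \<beta> (p x) = j})"
    by (rule psi_block_numbering[OF P B])
  \<comment> \<open>The class of an opener is the set counted by the matrix entry, so its rank stays below the entry.\<close>
  have opener: "g x \<in> half_arcs (psi M)" if x: "x \<in> {1..N}" "x < p x" for x
  proof -
    have "rank x < card (cls x)"
      unfolding rank_def
    proof (rule psubset_card_mono)
      have "x \<in> cls x" using x by (simp add: cls_def)
      then show "{y\<in>cls x. y < x} \<subset> cls x" by blast
    qed (rule fin)
    also have "cls x = {y\<in>{1..N}. y < p y \<and> \<beta> y = \<beta> x \<and> \<beta> (p y) = \<beta> (p x)}"
    proof -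
      have "p y < y \<longleftrightarrow> \<not> y < p y" if "y \<in> {1..N}" for y using p(2)[OF that] by auto
      then show ?thesis using x unfolding cls_def by blast
    qed
    finally show ?thesis using x bk p(1) by (simp add: g_def half_arcs_def psi)
  qed
  have "g x \<in> half_arcs (psi M)" if x: "x \<in> {1..N}" for x
  proof (cases "x < p x")
    case False
    then have "p x < p (p x)" using p(2,3)[OF x] by simp
    then have "g (p x) \<in> half_arcs (psi M)" using opener p(1)[OF x] by blast
    then show ?thesis using gp[OF x] by simp
  qed (use opener x in blast)
  then have "g ` {1..N} \<subseteq> half_arcs (psi M)" by blast
  moreover have "inj_on g {1..N}" using less by (metis inj_onI less_irrefl linorder_neqE_nat)
  then have "card (g ` {1..N}) = card (half_arcs (psi M))"
    using T_D(3)[OF psi_in_T[OF pairs_up_imp_is_matching assms(2)]] assms(1)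
    by (simp add: card_image card_half_arcs N_def)
  ultimately have "g ` {1..N} = half_arcs (psi M)" by (intro card_subset_eq finite_half_arcs)
  then have "labels N p (psi M) g" unfolding labels_def using less gp by blast
  then show thesis using that by (simp add: N_def)
qed

theorem theorem8:
  fixes n :: nat
  assumes "n \<ge> 1"
  shows "bij_betw psi {M. is_matching (2 * n) M \<and> no_neighbor_nestings M} (T n)"
  unfolding bij_betw_def
proof
  show "inj_on psi {M. is_matching (2 * n) M \<and> no_neighbor_nestings M}"
  proof (rule inj_onI; clarify)
    fix M M' assume M: "is_matching (2 * n) M" "no_neighbor_nestings M"
      and M': "is_matching (2 * n) M'" "no_neighbor_nestings M'" and eq: "psi M = psi M'"
    obtain p where P: "pairs_up (2 * n) p M" using is_matching_imp_pairs_up[OF M(1)] .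
    obtain q where Q: "pairs_up (2 * n) q M'" using is_matching_imp_pairs_up[OF M'(1)] .
    obtain g where g: "labels (2 * n) p (psi M) g"
      using no_neighbor_nestings_imp_labels[OF P assms M(2)] .
    obtain h where h: "labels (2 * n) q (psi M) h"
      using no_neighbor_nestings_imp_labels[OF Q assms M'(2)] eq by metis
    have "p x = q x" if x: "x \<in> {1..2 * n}" for x
    proof (rule inj_onD[OF labelsD(5)[OF g]])
      have "g (p x) = h (q x)"
        using labelsD(3)[OF g x] labelsD(3)[OF h x] labels_unique[OF g h x] by simp
      then show "g (p x) = g (q x)"
        using labels_unique[OF g h pairs_upD(1)[OF Q x]] by simp
    qed (use pairs_upD(1) P Q x in auto)
    then show "M = M'" using P Q by (auto simp: pairs_up_def)
  qed
  show "psi ` {M. is_matching (2 * n) M \<and> no_neighbor_nestings M} = T n"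
  proof
    show "psi ` {M. is_matching (2 * n) M \<and> no_neighbor_nestings M} \<subseteq> T n"
      using psi_in_T assms by blast
    show "T n \<subseteq> psi ` {M. is_matching (2 * n) M \<and> no_neighbor_nestings M}"
    proof
      fix A assume A: "A \<in> T n"
      obtain p M g where P: "pairs_up (2 * n) p M" and L: "labels (2 * n) p A g"
        using ex_labels[OF A] .
      show "A \<in> psi ` {M. is_matching (2 * n) M \<and> no_neighbor_nestings M}"
        using labels_psi[OF A P L] labels_no_neighbor_nestings[OF A P L]
          pairs_up_imp_is_matching[OF P] by blast
    qed
  qed
qed

end
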